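(* Let $p \geq 97$ be a prime, let $\alpha, \gamma \in \mathbb{F}_p$ with $\alpha \neq 0$, and let $$\mathcal{S} = \{(x,y) \in \mathbb{F}_p^2 : y < \alpha x^2 + \gamma\}.$$ Embed the affine plane $\mathrm{AG}(2,p)$ into the projective plane $\mathrm{PG}(2,p)$ and consider $\mathcal{S}$ as a point set in $\mathrm{PG}(2,p)$. Then the only non-trivial element of $\mathrm{PGL}(3,p)$ that stabilises $\mathcal{S}$ setwise is $(X,Y,Z) \mapsto (-X,Y,Z)$.
   Context: Every element of $\mathbb{F}_p$ corresponds to a unique integer in $\{0,1,\dots,p-1\}$; write $\nu(x)$ for the integer corresponding to $x \in \mathbb{F}_p$. The order relation $<$ on $\mathbb{F}_p$ is the one induced by this: $x<y$ if and only if $\nu(x)<\nu(y)$ in $\mathbb{Z}$. $\mathrm{AG}(2,p)$ is the affine plane with point set $\mathbb{F}_p^2$, embedded in $\mathrm{PG}(2,p)$ (with homogeneous coordinates $(X,Y,Z)$) by sending $(x,y)$ to the point with homogeneous coordinates $(x,y,1)$. $\mathrm{PGL}(3,p)$ acts on the points of $\mathrm{PG}(2,p)$ in the usual way. *)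

theory Defs
  imports
    "HOL-Analysis.Analysis"
    "HOL-Algebra.Group_Action"
    "Berlekamp_Zassenhaus.Finite_Field"
begin

text \<open>
  The field with \<open>p\<close> elements is \<open>'p mod_ring\<close> for \<open>'p :: prime_card\<close>, where \<open>p = CARD('p)\<close>;
  \<^const>\<open>to_int_mod_ring\<close> returns the representative in \<open>{0..<int p}\<close>.
\<close>

definition mod_ring_less :: "'p::prime_card mod_ring \<Rightarrow> 'p mod_ring \<Rightarrow> bool" where
  "mod_ring_less x y \<longleftrightarrow> to_int_mod_ring x < to_int_mod_ring y"

definition below_parabola ::
    "'p::prime_card mod_ring \<Rightarrow> 'p mod_ring \<Rightarrow> ('p mod_ring \<times> 'p mod_ring) set" where
  "below_parabola \<alpha> \<gamma> = {(x, y). mod_ring_less y (\<alpha> * x\<^sup>2 + \<gamma>)}"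


text \<open>Points of the projective plane are the one-dimensional subspaces of \<open>'a ^ 3\<close>.\<close>

definition PG2 :: "('a::field ^ 3) set set" where
  "PG2 = {P. vec.subspace P \<and> vec.dim P = 1}"

definition homogeneous_point :: "'a::field \<Rightarrow> 'a \<Rightarrow> 'a \<Rightarrow> ('a ^ 3) set" where
  "homogeneous_point X Y Z = vec.span {vector [X, Y, Z]}"

definition AG2_embed :: "'a::field \<times> 'a \<Rightarrow> ('a ^ 3) set" where
  "AG2_embed = (\<lambda>(x, y). homogeneous_point x y 1)"


definition GL3 :: "('a::field ^ 3 ^ 3) monoid" where
  "GL3 = \<lparr>carrier = {A. invertible A}, mult = (**), one = mat 1\<rparr>"

definition scalar_matrices3 :: "('a::field ^ 3 ^ 3) set" where
  "scalar_matrices3 = {mat c | c. c \<noteq> 0}"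

definition PGL3 :: "('a::field ^ 3 ^ 3) set monoid" where
  "PGL3 = GL3 Mod scalar_matrices3"

text \<open>The element of \<open>PGL\<close> represented by an invertible matrix.\<close>

definition PGL3_class :: "'a::field ^ 3 ^ 3 \<Rightarrow> ('a ^ 3 ^ 3) set" where
  "PGL3_class A = scalar_matrices3 #>\<^bsub>GL3\<^esub> A"

text \<open>
  Matrices act on column vectors from the left. All representatives of an element of \<open>PGL\<close> send
  a point to the same point, so the union below is the image under any one of them
  (see \<open>PGL3_act_class\<close>).
\<close>

definition PGL3_act :: "('a::field ^ 3 ^ 3) set \<Rightarrow> ('a ^ 3) set \<Rightarrow> ('a ^ 3) set" where
  "PGL3_act g = (\<lambda>P \<in> PG2. \<Union>A \<in> g. (*v) A ` P)"


lemma GL3_group: "group (GL3 :: ('a::field ^ 3 ^ 3) monoid)"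
proof (rule groupI)
  fix x :: "'a ^ 3 ^ 3" assume "x \<in> carrier GL3"
  then obtain y where "x ** y = mat 1" "y ** x = mat 1"
    by (auto simp: GL3_def invertible_def)
  then show "\<exists>y \<in> carrier GL3. y \<otimes>\<^bsub>GL3\<^esub> x = \<one>\<^bsub>GL3\<^esub>"
    by (auto simp: GL3_def invertible_def)
next
  show "\<one>\<^bsub>GL3\<^esub> \<in> carrier (GL3 :: ('a ^ 3 ^ 3) monoid)"
    by (auto simp: GL3_def invertible_def intro!: exI[of _ "mat 1"])
qed (auto simp: GL3_def matrix_mul_assoc invertible_mult)

lemma scalar_mult_matrix: "mat c ** A = (\<chi> i j. c * A $ i $ j)" for A :: "'a::field ^ 'n ^ 'n"
  by (simp add: vec_eq_iff matrix_matrix_mult_def mat_def if_distrib if_distribR cong: if_cong)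

lemma matrix_mult_scalar: "A ** mat c = mat c ** A" for A :: "'a::field ^ 'n ^ 'n"
  unfolding scalar_mult_matrix
  by (simp add: vec_eq_iff matrix_matrix_mult_def mat_def if_distrib if_distribR mult.commute
      cong: if_cong)

lemma scalar_mult_scalar: "mat c ** mat d = (mat (c * d) :: 'a::field ^ 'n ^ 'n)"
  unfolding scalar_mult_matrix by (simp add: vec_eq_iff mat_def)

lemma scalar_mult_vector: "mat c *v v = c *s v" for v :: "'a::field ^ 'n"
  by (simp add: vec_eq_iff matrix_vector_mult_def mat_def if_distrib if_distribR cong: if_cong)

lemma scalar_matrix_invertible: "c \<noteq> 0 \<Longrightarrow> invertible (mat c :: 'a::field ^ 'n ^ 'n)"
  unfolding invertible_def by (rule exI[of _ "mat (1 / c)"]) (simp add: scalar_mult_scalar)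

lemma scalar_matrices3_normal: "scalar_matrices3 \<lhd> (GL3 :: ('a::field ^ 3 ^ 3) monoid)"
proof -
  interpret group "GL3 :: ('a ^ 3 ^ 3) monoid" by (rule GL3_group)
  have inv_scalar: "inv\<^bsub>GL3\<^esub> (mat c) = (mat (1 / c) :: 'a ^ 3 ^ 3)" if "c \<noteq> 0" for c
  proof (rule inv_equality)
    show "mat (1 / c) \<otimes>\<^bsub>GL3\<^esub> mat c = (\<one>\<^bsub>GL3\<^esub> :: 'a ^ 3 ^ 3)"
      using that by (simp add: GL3_def scalar_mult_scalar)
    show "mat c \<in> carrier (GL3 :: ('a ^ 3 ^ 3) monoid)"
      "mat (1 / c) \<in> carrier (GL3 :: ('a ^ 3 ^ 3) monoid)"
      using that by (simp_all add: GL3_def scalar_matrix_invertible)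
  qed
  have sub: "subgroup scalar_matrices3 (GL3 :: ('a ^ 3 ^ 3) monoid)"
  proof (rule subgroupI)
    show "scalar_matrices3 \<subseteq> carrier (GL3 :: ('a ^ 3 ^ 3) monoid)"
      by (auto simp: scalar_matrices3_def GL3_def scalar_matrix_invertible)
    show "scalar_matrices3 \<noteq> ({} :: ('a ^ 3 ^ 3) set)"
      by (auto simp: scalar_matrices3_def intro: exI[of _ 1])
  next
    fix a :: "'a ^ 3 ^ 3" assume "a \<in> scalar_matrices3"
    then obtain c where c: "a = mat c" "c \<noteq> 0" by (auto simp: scalar_matrices3_def)
    then show "inv\<^bsub>GL3\<^esub> a \<in> scalar_matrices3"
      unfolding c(1) inv_scalar[OF c(2)] scalar_matrices3_def
      by (intro CollectI exI[of _ "1 / c"]) simp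
  next
    fix a b :: "'a ^ 3 ^ 3" assume "a \<in> scalar_matrices3" "b \<in> scalar_matrices3"
    then obtain c d where "a = mat c" "b = mat d" "c * d \<noteq> 0"
      by (auto simp: scalar_matrices3_def)
    then show "a \<otimes>\<^bsub>GL3\<^esub> b \<in> scalar_matrices3"
      by (auto simp: GL3_def scalar_mult_scalar scalar_matrices3_def)
  qed
  have "x \<otimes>\<^bsub>GL3\<^esub> h \<otimes>\<^bsub>GL3\<^esub> inv\<^bsub>GL3\<^esub> x = h"
    if "x \<in> carrier GL3" "h \<in> scalar_matrices3" for x h :: "'a ^ 3 ^ 3"
  proof -
    have h: "h \<in> carrier GL3" using that(2) subgroup.subset[OF sub] by blast
    have "x \<otimes>\<^bsub>GL3\<^esub> h = h \<otimes>\<^bsub>GL3\<^esub> x"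
      using that(2) by (auto simp: scalar_matrices3_def GL3_def matrix_mult_scalar)
    then show ?thesis using that(1) h by (simp add: m_assoc)
  qed
  then show ?thesis using sub by (simp add: normal_inv_iff)
qed

lemma PGL3_group: "group (PGL3 :: ('a::field ^ 3 ^ 3) set monoid)"
  unfolding PGL3_def by (rule normal.factorgroup_is_group[OF scalar_matrices3_normal])

lemma carrier_PGL3: "carrier PGL3 = PGL3_class ` {A :: 'a::field ^ 3 ^ 3. invertible A}"
  by (auto simp: PGL3_def FactGroup_def RCOSETS_def PGL3_class_def GL3_def)

lemma one_PGL3: "\<one>\<^bsub>PGL3\<^esub> = PGL3_class (mat 1 :: 'a::field ^ 3 ^ 3)"
  by (auto simp: PGL3_def FactGroup_def PGL3_class_def r_coset_def GL3_def)

lemma PGL3_class_eq: "PGL3_class A = {mat c ** A | c. c \<noteq> 0}"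
  by (auto simp: PGL3_class_def r_coset_def GL3_def scalar_matrices3_def)

lemma PGL3_class_mult:
  assumes "invertible A" "invertible B"
  shows "PGL3_class A \<otimes>\<^bsub>PGL3\<^esub> PGL3_class B = PGL3_class (A ** B)"
  using normal.rcos_sum[OF scalar_matrices3_normal, of A B] assms
  by (simp add: PGL3_def FactGroup_def PGL3_class_def GL3_def)

lemma PG2_eq_span: "PG2 = {vec.span {v :: 'a::field ^ 3} | v. v \<noteq> 0}"
proof (intro equalityI subsetI)
  fix P :: "('a ^ 3) set" assume "P \<in> PG2"
  then have P: "vec.subspace P" "vec.dim P = 1" by (auto simp: PG2_def)
  obtain B where B: "B \<subseteq> P" "vec.independent B" "P \<subseteq> vec.span B" "card B = vec.dim P"
    using vec.basis_exists by blast
  then obtain v where "B = {v}" using P(2) by (auto simp: card_1_singleton_iff)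
  moreover from this have "v \<noteq> 0" using B(2) by (auto simp: vec.dependent_single)
  moreover have "P = vec.span B" using B P(1) by (simp add: vec.span_minimal subset_antisym)
  ultimately show "P \<in> {vec.span {v} | v. v \<noteq> 0}" by blast
next
  fix P :: "('a ^ 3) set" assume "P \<in> {vec.span {v} | v. v \<noteq> 0}"
  then show "P \<in> PG2"
    by (auto simp: PG2_def vec.dim_span vec.dim_eq_card_independent[of "{_}"])
qed

lemma AG2_embed_in_PG2: "AG2_embed q \<in> PG2"
proof (cases q)
  case (Pair x y)
  have "(vector [x, y, 1] :: 'a ^ 3) $ 3 \<noteq> 0 $ 3" by simp
  then have "(vector [x, y, 1] :: 'a ^ 3) \<noteq> 0" by metis
  then show ?thesis
    unfolding Pair AG2_embed_def homogeneous_point_def PG2_eq_span by auto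
qed

lemma PGL3_act_class:
  assumes "P \<in> PG2"
  shows "PGL3_act (PGL3_class A) P = (*v) A ` P"
proof -
  have sub: "vec.subspace P" using assms by (simp add: PG2_def)
  have "(mat c ** A) *v v = A *v (c *s v)" for c v
    by (metis matrix_mult_scalar matrix_vector_mul_assoc scalar_mult_vector)
  then have "(\<Union>B \<in> PGL3_class A. (*v) B ` P) \<subseteq> (*v) A ` P"
    using vec.subspace_scale[OF sub] by (auto simp: PGL3_class_eq)
  moreover have "mat 1 ** A \<in> PGL3_class A"
    unfolding PGL3_class_eq by (intro CollectI exI[of _ 1]) simp
  then have "(*v) A ` P \<subseteq> (\<Union>B \<in> PGL3_class A. (*v) B ` P)" by auto
  ultimately show ?thesis using assms by (simp add: PGL3_act_def subset_antisym)
qed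

lemma matrix_image_span: "(*v) A ` vec.span {v} = vec.span {A *v v}" for A :: "'a::field ^ 3 ^ 3"
  using vec.linear_span_image[OF matrix_vector_mul_linear_gen, of A "{v}"] by simp

lemma matrix_image_in_PG2:
  assumes "invertible A" "P \<in> PG2"
  shows "(*v) A ` P \<in> PG2"
proof -
  obtain v where v: "P = vec.span {v}" "v \<noteq> 0" using assms(2) by (auto simp: PG2_eq_span)
  have "A *v v \<noteq> 0"
    using inj_matrix_vector_mult[OF assms(1)] v(2) by (auto dest: injD[of _ v 0])
  moreover have "(*v) A ` P = vec.span {A *v v}"
    unfolding v(1) by (rule matrix_image_span)
  ultimately show ?thesis by (auto simp: PG2_eq_span)
qed

lemma PGL3_act_homogeneous_point:
  assumes "(X, Y, Z) \<noteq> (0, 0, 0)"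
  shows "PGL3_act (PGL3_class A) (homogeneous_point X Y Z) = vec.span {A *v vector [X, Y, Z]}"
proof -
  have "(vector [X, Y, Z] :: 'a ^ 3) \<noteq> 0"
    using assms by (auto simp: vec_eq_iff forall_3)
  then have "homogeneous_point X Y Z \<in> PG2" by (auto simp: homogeneous_point_def PG2_eq_span)
  then show ?thesis
    by (simp only: PGL3_act_class) (simp only: homogeneous_point_def matrix_image_span)
qed

lemma PGL3_group_action: "group_action (PGL3 :: ('a::field ^ 3 ^ 3) set monoid) PG2 PGL3_act"
proof -
  have act_mult: "PGL3_act (PGL3_class (A ** B)) P
      = PGL3_act (PGL3_class A) (PGL3_act (PGL3_class B) P)"
    if "invertible A" "invertible B" "P \<in> PG2" for A B :: "'a ^ 3 ^ 3" and P
    using that by (simp add: PGL3_act_class matrix_image_in_PG2 image_image matrix_vector_mul_assoc)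
  have act_one: "PGL3_act (PGL3_class (mat 1)) P = P" if "P \<in> PG2" for P :: "('a ^ 3) set"
    using that by (simp add: PGL3_act_class)
  have bij: "PGL3_act (PGL3_class A) \<in> Bij PG2" if "invertible A" for A :: "'a ^ 3 ^ 3"
  proof -
    obtain B where B: "A ** B = mat 1" "B ** A = mat 1" using \<open>invertible A\<close>
      by (auto simp: invertible_def)
    then have iB: "invertible B" by (auto simp: invertible_def)
    have "bij_betw (PGL3_act (PGL3_class A)) PG2 PG2"
      by (rule bij_betw_byWitness[where f' = "PGL3_act (PGL3_class B)"])
        (use B iB that in \<open>auto simp: act_one act_mult[symmetric]\<close>,
         auto simp: PGL3_act_class matrix_image_in_PG2)
    then show ?thesis by (simp add: Bij_def PGL3_act_def)
  qed
  have "PGL3_act \<in> hom PGL3 (BijGroup PG2 :: (('a ^ 3) set \<Rightarrow> ('a ^ 3) set) monoid)"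
  proof (rule homI)
    fix g :: "('a ^ 3 ^ 3) set" assume "g \<in> carrier PGL3"
    then show "PGL3_act g \<in> carrier (BijGroup PG2)"
      using bij by (auto simp: carrier_PGL3 BijGroup_def)
  next
    fix g h :: "('a ^ 3 ^ 3) set" assume "g \<in> carrier PGL3" "h \<in> carrier PGL3"
    then obtain A B where AB: "g = PGL3_class A" "h = PGL3_class B" "invertible A" "invertible B"
      by (auto simp: carrier_PGL3)
    have "PGL3_act (PGL3_class (A ** B))
        = compose PG2 (PGL3_act (PGL3_class A)) (PGL3_act (PGL3_class B))"
    proof (rule extensionalityI[of _ PG2])
      show "PGL3_act (PGL3_class (A ** B)) \<in> extensional PG2" by (simp add: PGL3_act_def)
    qed (auto simp: compose_def act_mult AB)
    then show "PGL3_act (g \<otimes>\<^bsub>PGL3\<^esub> h) = PGL3_act g \<otimes>\<^bsub>BijGroup PG2\<^esub> PGL3_act h"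
      using AB bij by (simp add: BijGroup_def PGL3_class_mult)
  qed
  then show ?thesis
    unfolding group_action_def group_hom_def group_hom_axioms_def
    by (simp add: PGL3_group group_BijGroup)
qed

end

theory Submission
  imports Defs
begin

text \<open>
  Write \<open>\<nu> x\<close> for the representative of \<open>x\<close> in \<open>{0..<p}\<close>. Since \<open>p * [y < z] = \<nu> (y - z) - \<nu> y + \<nu> z\<close>,
  the number of points of \<open>S\<close> on a line that is parallel to neither axis is
  \<open>(|S| + Q k) / p\<close> for some \<open>k\<close>, where \<open>Q k = (\<Sum>x. \<nu> (k - \<alpha> * x\<^sup>2) - (p - 1) / 2)\<close>. The sum of all
  \<open>(Q k)\<^sup>2\<close> is \<open>p\<^sup>2 * (p\<^sup>2 - 1) / 12\<close>, and \<open>Q\<close> moves by at most \<open>p\<close> from \<open>k\<close> to \<open>k + 1\<close>, so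
  \<open>\<bar>Q k\<bar> \<le> p * (p / 4 - 1)\<close>. Lines that violate this bound are called exceptional; they are the line
  at infinity or axis-parallel, and there are at least three through each of the points at infinity of
  the two axes. A projectivity stabilising \<open>S\<close> permutes the exceptional lines, so it fixes
  or swaps these two points and is thus affine, of diagonal or antidiagonal linear part. Comparing the
  centroids of the columns and rows of \<open>S\<close> leaves only the identity and the reflection.
\<close>

section \<open>Sums of representatives along a quadratic\<close>

lemma sum_UNIV_reindex:
  fixes g :: "'a::finite \<Rightarrow> 'c::comm_monoid_add" and h :: "'a \<Rightarrow> 'a"
  assumes "inj h"
  shows "(\<Sum>x\<in>UNIV. g (h x)) = (\<Sum>x\<in>UNIV. g x)"
  using sum.reindex[OF assms, of g] finite_UNIV_inj_surj[OF finite assms] by (simp add: o_def)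

text \<open>Expanding the square leaves the autocorrelation of \<open>w\<close> at
  \<open>\<alpha> * (x\<^sup>2 - y\<^sup>2)\<close>. For a fixed nonzero \<open>x - y\<close> this
  argument runs once through the whole field, where the autocorrelation sums to zero, so only the
  terms with \<open>x = y\<close> survive.\<close>

lemma sum_squares_quadratic_translates:
  fixes w :: "'a::{field,finite} \<Rightarrow> real"
  assumes two: "(2 :: 'a) \<noteq> 0" and "\<alpha> \<noteq> 0" and w: "(\<Sum>k\<in>UNIV. w k) = 0"
  shows "(\<Sum>k\<in>UNIV. (\<Sum>x\<in>UNIV. w (k - \<alpha> * x\<^sup>2))\<^sup>2) = CARD('a) * (\<Sum>k\<in>UNIV. (w k)\<^sup>2)"
proof -
  define A where "A d = (\<Sum>k\<in>UNIV. w k * w (k + d))" for d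
  have "(\<Sum>d\<in>UNIV. A d) = (\<Sum>k\<in>UNIV. w k * (\<Sum>d\<in>UNIV. w (k + d)))"
    unfolding A_def sum_distrib_left by (rule sum.swap)
  also have "\<dots> = 0" by (simp add: sum_UNIV_reindex[of "\<lambda>d. k + d" w for k] w)
  finally have sumA: "(\<Sum>d\<in>UNIV. A d) = 0" .
  have "(\<Sum>k\<in>UNIV. (\<Sum>x\<in>UNIV. w (k - \<alpha> * x\<^sup>2))\<^sup>2)
      = (\<Sum>k\<in>UNIV. \<Sum>x\<in>UNIV. \<Sum>y\<in>UNIV. w (k - \<alpha> * x\<^sup>2) * w (k - \<alpha> * y\<^sup>2))"
    by (simp add: power2_eq_square sum_product)
  also have "\<dots> = (\<Sum>x\<in>UNIV. \<Sum>k\<in>UNIV. \<Sum>y\<in>UNIV. w (k - \<alpha> * x\<^sup>2) * w (k - \<alpha> * y\<^sup>2))"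
    by (rule sum.swap)
  also have "\<dots> = (\<Sum>x\<in>UNIV. \<Sum>y\<in>UNIV. \<Sum>k\<in>UNIV. w (k - \<alpha> * x\<^sup>2) * w (k - \<alpha> * y\<^sup>2))"
    by (intro sum.cong refl sum.swap)
  also have "\<dots> = (\<Sum>x\<in>UNIV. \<Sum>y\<in>UNIV. A (\<alpha> * (x - y) * (x + y)))"
  proof (intro sum.cong refl)
    fix x y
    show "(\<Sum>k\<in>UNIV. w (k - \<alpha> * x\<^sup>2) * w (k - \<alpha> * y\<^sup>2)) = A (\<alpha> * (x - y) * (x + y))"
      using sum_UNIV_reindex[of "\<lambda>k. k - \<alpha> * x\<^sup>2" "\<lambda>k. w k * w (k + \<alpha> * (x - y) * (x + y))"]
      unfolding A_def by (simp add: inj_def algebra_simps power2_eq_square)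
  qed
  also have "\<dots> = (\<Sum>z\<in>UNIV. case z of (x, y) \<Rightarrow> A (\<alpha> * (x - y) * (x + y)))"
    by (simp add: sum.cartesian_product)
  \<comment> \<open>the substitution \<open>u = x - y\<close>, \<open>v = x + y\<close> linearises the argument of the autocorrelation \<open>A\<close>\<close>
  also have "\<dots> = (\<Sum>z\<in>UNIV. case z of (u, v) \<Rightarrow> A (\<alpha> * u * v))"
  proof -
    have "inj (\<lambda>(x :: 'a, y). (x - y, x + y))"
    proof (rule injI, clarify)
      fix x y x' y' :: 'a assume *: "x - y = x' - y'" "x + y = x' + y'"
      have "2 * x = (x - y) + (x + y)" by simp
      also have "\<dots> = 2 * x'" unfolding * by simp
      finally have "x = x'" using two by simp
      then show "x = x' \<and> y = y'" using * by simp
    qed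
    from sum_UNIV_reindex[OF this, of "\<lambda>(u, v). A (\<alpha> * u * v)"]
    show ?thesis by (simp add: case_prod_unfold)
  qed
  also have "\<dots> = (\<Sum>u\<in>UNIV. \<Sum>v\<in>UNIV. A (\<alpha> * u * v))"
    by (simp add: sum.cartesian_product)
  also have "\<dots> = (\<Sum>u::'a\<in>UNIV. if u = 0 then CARD('a) * A 0 else 0)"
  proof (intro sum.cong refl)
    fix u
    show "(\<Sum>v\<in>UNIV. A (\<alpha> * u * v)) = (if u = 0 then CARD('a) * A 0 else 0)"
      using sum_UNIV_reindex[of "\<lambda>v. \<alpha> * u * v" A] \<open>\<alpha> \<noteq> 0\<close> sumA by (auto simp: inj_def)
  qed
  also have "\<dots> = CARD('a) * (\<Sum>k\<in>UNIV. (w k)\<^sup>2)"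
    by (simp add: A_def power2_eq_square)
  finally show ?thesis .
qed

section \<open>Moments of the centred representatives\<close>

definition centred :: "'p::prime_card mod_ring \<Rightarrow> real" where
  "centred x = of_int (to_int_mod_ring x) - (real CARD('p) - 1) / 2"

lemma to_int_mod_ring_bounds:
  "0 \<le> to_int_mod_ring x" "to_int_mod_ring x < int CARD('p)" for x :: "'p::prime_card mod_ring"
  using range_to_int_mod_ring[where 'a = 'p] by (auto simp: set_eq_iff image_iff)

lemma to_int_mod_ring_diff:
  "to_int_mod_ring (x - y) = (to_int_mod_ring x - to_int_mod_ring y) mod int CARD('p)"
  for x y :: "'p::prime_card mod_ring"
  by transfer simp

lemma sum_to_int_mod_ring:
  "(\<Sum>x\<in>UNIV. g (to_int_mod_ring (x :: 'p::prime_card mod_ring))) = (\<Sum>i<CARD('p). g (int i))"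
proof -
  have "inj (to_int_mod_ring :: 'p mod_ring \<Rightarrow> int)"
    by (metis injI of_int_mod_ring_to_int_mod_ring)
  then have "(\<Sum>x\<in>UNIV. g (to_int_mod_ring (x :: 'p mod_ring))) = sum g {0..<int CARD('p)}"
    using sum.reindex[of "to_int_mod_ring :: 'p mod_ring \<Rightarrow> int" UNIV g]
    by (simp add: range_to_int_mod_ring o_def)
  also have "\<dots> = (\<Sum>i<CARD('p). g (int i))"
    by (rule sum.reindex_bij_witness[of _ int nat]) auto
  finally show ?thesis .
qed

lemma sum_centred: "(\<Sum>x\<in>UNIV. centred (x :: 'p::prime_card mod_ring)) = 0"
proof -
  have "(\<Sum>i<n. real i) = n * (real n - 1) / 2" for n
    by (induction n) (auto simp: field_simps)
  then show ?thesis
    using sum_to_int_mod_ring[where 'p = 'p, of "real_of_int"]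
    by (simp add: centred_def sum_subtractf)
qed

lemma sum_centred_squared:
  "(\<Sum>x\<in>UNIV. (centred (x :: 'p::prime_card mod_ring))\<^sup>2) = real CARD('p) * ((real CARD('p))\<^sup>2 - 1) / 12"
proof -
  \<comment> \<open>The shift \<open>c\<close> stays independent of \<open>n\<close> for the
    induction and is set to the mean afterwards.\<close>
  have "(\<Sum>i<n. (real i - c)\<^sup>2)
      = n * (real n - 1) * (2 * real n - 1) / 6 - c * n * (real n - 1) + n * c\<^sup>2" for n c
    by (induction n) (auto simp: field_simps power2_eq_square)
  from this[of "(real CARD('p) - 1) / 2" "CARD('p)"] show ?thesis
    using sum_to_int_mod_ring[where 'p = 'p, of "\<lambda>i. (real_of_int i - (real CARD('p) - 1) / 2)\<^sup>2"]
    by (simp add: centred_def) (simp add: field_simps power2_eq_square)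
qed

text \<open>\<open>y < z\<close> holds exactly when subtracting \<open>z\<close> from \<open>y\<close> borrows.\<close>

lemma CARD_times_of_bool_less:
  fixes y z :: "'p::prime_card mod_ring"
  shows "real CARD('p) * of_bool (mod_ring_less y z)
    = centred (y - z) - centred y + of_int (to_int_mod_ring z)"
proof -
  let ?d = "to_int_mod_ring y - to_int_mod_ring z"
  have "?d mod int CARD('p) = (if ?d < 0 then ?d + int CARD('p) else ?d)"
    using to_int_mod_ring_bounds[of y] to_int_mod_ring_bounds[of z]
    using mod_pos_pos_trivial[of ?d "int CARD('p)"] mod_pos_pos_trivial[of "?d + int CARD('p)" "int CARD('p)"]
    by (simp split: if_split)
  then show ?thesis
    by (auto simp: centred_def mod_ring_less_def to_int_mod_ring_diff)
qed

lemma card_quadratic_fibre_le: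
  fixes \<alpha> k :: "'a::{field,finite}"
  assumes "\<alpha> \<noteq> 0"
  shows "card {x. \<alpha> * x\<^sup>2 = k} \<le> 2"
proof (cases "\<exists>x. \<alpha> * x\<^sup>2 = k")
  case True
  then obtain x0 where "\<alpha> * x0\<^sup>2 = k" ..
  then have "{x. \<alpha> * x\<^sup>2 = k} \<subseteq> {x0, - x0}" using assms by (auto simp: power2_eq_iff)
  then have "card {x. \<alpha> * x\<^sup>2 = k} \<le> card {x0, - x0}" by (rule card_mono[rotated]) simp
  also have "\<dots> \<le> 2" by (simp add: card_insert_if)
  finally show ?thesis .
qed simp

definition quadratic_sum :: "'p::prime_card mod_ring \<Rightarrow> 'p mod_ring \<Rightarrow> real" where
  "quadratic_sum \<alpha> k = (\<Sum>x\<in>UNIV. centred (k - \<alpha> * x\<^sup>2))"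

text \<open>Subtracting 1 borrows only at 0, where the representative jumps to \<open>p - 1\<close>.
  At \<open>x = 0\<close> this also evaluates the representative of -1.\<close>

lemma centred_diff_one: "centred x - centred (x - 1) = 1 - real CARD('p) * of_bool (x = 0)"
  for x :: "'p::prime_card mod_ring"
proof -
  have "mod_ring_less x 1 \<longleftrightarrow> to_int_mod_ring x = 0"
    using to_int_mod_ring_bounds(1)[of x] unfolding mod_ring_less_def to_int_mod_ring_hom.hom_one by linarith
  then have "mod_ring_less x 1 \<longleftrightarrow> x = 0" by simp
  then show ?thesis using CARD_times_of_bool_less[of x 1] by simp
qed

text \<open>Every \<open>x\<close> contributes 1 to the change, less \<open>p\<close> where the
  representative wraps around, at \<open>\<alpha> * x\<^sup>2 = k\<close>. With \<open>N\<close>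
  such points the change is \<open>p * (1 - N)\<close>, and \<open>N \<le> 2\<close>.\<close>

lemma quadratic_sum_step:
  fixes \<alpha> k :: "'p::prime_card mod_ring"
  assumes "\<alpha> \<noteq> 0"
  shows "\<bar>quadratic_sum \<alpha> k - quadratic_sum \<alpha> (k - 1)\<bar> \<le> CARD('p)"
proof -
  have "quadratic_sum \<alpha> k - quadratic_sum \<alpha> (k - 1)
      = (\<Sum>x\<in>UNIV. centred (k - \<alpha> * x\<^sup>2) - centred (k - \<alpha> * x\<^sup>2 - 1))"
    by (simp add: quadratic_sum_def sum_subtractf algebra_simps)
  also have "\<dots> = CARD('p) - CARD('p) * real (card {x. \<alpha> * x\<^sup>2 = k})"
    by (simp add: centred_diff_one sum_subtractf sum_distrib_left[symmetric] of_bool_def sum.If_cases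
        eq_commute[of k])
  also have "\<dots> = CARD('p) * (1 - real (card {x. \<alpha> * x\<^sup>2 = k}))"
    by (simp add: algebra_simps)
  finally have "\<bar>quadratic_sum \<alpha> k - quadratic_sum \<alpha> (k - 1)\<bar>
      = CARD('p) * \<bar>1 - real (card {x. \<alpha> * x\<^sup>2 = k})\<bar>" by (simp add: abs_mult)
  moreover have "\<bar>1 - real (card {x. \<alpha> * x\<^sup>2 = k})\<bar> \<le> 1"
    using card_quadratic_fibre_le[OF assms, of k] by linarith
  ultimately show ?thesis by (simp add: mult_left_le)
qed

lemma of_nat_mod_ring_eq_0_iff: "(of_nat n :: 'p::prime_card mod_ring) = 0 \<longleftrightarrow> CARD('p) dvd n"
proof -
  have "(of_nat n :: 'p mod_ring) = 0 \<longleftrightarrow> int n mod int CARD('p) = 0" by transfer simp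
  then show ?thesis by (simp add: mod_eq_0_iff_dvd)
qed

lemma two_neq_zero_mod_ring: "CARD('p) \<ge> 3 \<Longrightarrow> (2 :: 'p::prime_card mod_ring) \<noteq> 0"
  using of_nat_mod_ring_eq_0_iff[where 'p = 'p, of 2] by (auto dest: dvd_imp_le)

text \<open>A value beyond the bound at \<open>k\<close> keeps its neighbours at
  \<open>k - 1\<close> and \<open>k + 1\<close> large, and these three squares alone would exceed
  the total second moment.\<close>

lemma quadratic_sum_bound:
  fixes \<alpha> k :: "'p::prime_card mod_ring"
  assumes "\<alpha> \<noteq> 0" and p: "CARD('p) \<ge> 25"
  shows "\<bar>quadratic_sum \<alpha> k\<bar> \<le> CARD('p) * (CARD('p) / 4 - 1)"
proof (rule ccontr)
  let ?p = "real CARD('p)" and ?Q = "quadratic_sum \<alpha>"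
  \<comment> \<open>This is the claimed bound less one step \<open>p\<close>, so all three absolute
    values exceed it.\<close>
  let ?m = "?p * (?p / 4 - 2)"
  assume "\<not> ?thesis"
  then have big: "\<bar>?Q k\<bar> > ?p * (?p / 4 - 1)" by simp
  have two: "(2 :: 'p mod_ring) \<noteq> 0" using p by (intro two_neq_zero_mod_ring) simp
  have Q: "(?Q k')\<^sup>2 > ?m\<^sup>2" if "k' \<in> {k - 1, k, k + 1}" for k'
  proof -
    have "?m < \<bar>?Q k'\<bar>"
      using that big quadratic_sum_step[OF assms(1), of k] quadratic_sum_step[OF assms(1), of "k + 1"]
      by (auto simp: algebra_simps)
    moreover have "0 \<le> ?m" using p by simp
    ultimately show ?thesis by (metis abs_of_nonneg power2_abs power2_strict_mono abs_ge_self)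
  qed
  have "card {k - 1, k, k + 1} = 3"
  proof -
    have "k - 1 \<noteq> k + 1"
    proof
      assume "k - 1 = k + 1"
      then have "(k + 1) - (k - 1) = 0" by simp
      then show False using two by simp
    qed
    then show ?thesis by (simp add: card_insert_if)
  qed
  then have "3 * ?m\<^sup>2 < (\<Sum>k'\<in>{k - 1, k, k + 1}. (?Q k')\<^sup>2)"
    using sum_strict_mono[of "{k - 1, k, k + 1}" "\<lambda>_. ?m\<^sup>2" "\<lambda>k'. (?Q k')\<^sup>2"] Q by simp
  also have "\<dots> \<le> (\<Sum>k'\<in>UNIV. (?Q k')\<^sup>2)" by (rule sum_mono2) auto
  also have "\<dots> = ?p * (?p * (?p\<^sup>2 - 1) / 12)"
    unfolding quadratic_sum_def sum_squares_quadratic_translates[OF two assms(1) sum_centred]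
    by (simp add: sum_centred_squared)
  finally have "3 * (?p / 4 - 2)\<^sup>2 * ?p\<^sup>2 < (?p\<^sup>2 - 1) / 12 * ?p\<^sup>2"
    by (simp add: power_mult_distrib algebra_simps power2_eq_square)
  then have "3 * (?p / 4 - 2)\<^sup>2 < (?p\<^sup>2 - 1) / 12"
    using p by (simp add: mult_less_cancel_right)
  \<comment> \<open>Clearing denominators gives
    \<open>9 * (p - 8)\<^sup>2 < 4 * (p\<^sup>2 - 1)\<close>; taking roots yields
    \<open>p < 24\<close>, against \<open>p \<ge> 25\<close>.\<close>
  then have "(3 * (?p - 8))\<^sup>2 < (2 * ?p)\<^sup>2"
    by (simp add: power2_eq_square algebra_simps)
  then have "3 * (?p - 8) < 2 * ?p" by (rule power2_less_imp_less) simp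
  then show False using p by simp
qed


section \<open>Intersection numbers of lines\<close>

text \<open>Homogeneous coefficients treat all lines alike: \<open>(0, 0, 1)\<close> is the line at
  infinity, which has no affine point, and matrices act linearly on the triples.\<close>

definition line_count :: "('a::field \<times> 'a) set \<Rightarrow> 'a \<Rightarrow> 'a \<Rightarrow> 'a \<Rightarrow> nat" where
  "line_count S a b c = card {(x, y) \<in> S. a * x + b * y + c = 0}"

definition column_total :: "'p::prime_card mod_ring \<Rightarrow> 'p mod_ring \<Rightarrow> real" where
  "column_total \<alpha> \<gamma> = (\<Sum>x\<in>UNIV. of_int (to_int_mod_ring (\<alpha> * x\<^sup>2 + \<gamma>)))"

text \<open>With the line written as \<open>y = r x\<close>, the borrow identity is summed over
  \<open>x\<close>, and completing the square turns its first term into a value of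
  \<open>quadratic_sum\<close>. The second sum is left unevaluated: it vanishes for slanted lines
  and is \<open>p\<close> times one value of \<open>centred\<close> for rows.\<close>

lemma line_count_nonvertical:
  fixes \<alpha> :: "'p::prime_card mod_ring"
  assumes "b \<noteq> 0" "\<alpha> \<noteq> 0" and two: "(2 :: 'p mod_ring) \<noteq> 0"
  shows "\<exists>k. CARD('p) * line_count (below_parabola \<alpha> \<gamma>) a b c
    = quadratic_sum \<alpha> k - (\<Sum>x\<in>UNIV. centred (- (a * x + c) / b)) + column_total \<alpha> \<gamma>"
proof -
  define r where "r x = - (a * x + c) / b" for x
  \<comment> \<open>The line has slope \<open>- a / b\<close>, and \<open>h\<close> is the abscissa
    where the parabola has the same slope; shifting by it removes the linear term.\<close>
  define h where "h = - a / b / (2 * \<alpha>)"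
  define k where "k = - c / b - \<gamma> + \<alpha> * h\<^sup>2"
  have on_line: "a * x + b * y + c = 0 \<longleftrightarrow> y = r x" for x y
    unfolding r_def using \<open>b \<noteq> 0\<close> by (simp add: field_simps add_eq_0_iff)
  have "line_count (below_parabola \<alpha> \<gamma>) a b c = card {x. mod_ring_less (r x) (\<alpha> * x\<^sup>2 + \<gamma>)}"
    unfolding line_count_def
    by (rule bij_betw_same_card[of fst], rule bij_betw_byWitness[where f' = "\<lambda>x. (x, r x)"])
      (auto simp: below_parabola_def on_line)
  then have "CARD('p) * line_count (below_parabola \<alpha> \<gamma>) a b c
      = (\<Sum>x\<in>UNIV. real CARD('p) * of_bool (mod_ring_less (r x) (\<alpha> * x\<^sup>2 + \<gamma>)))"
    by (simp add: sum_distrib_left[symmetric] of_bool_def sum.If_cases)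
  also have "\<dots> = (\<Sum>x\<in>UNIV. centred (r x - (\<alpha> * x\<^sup>2 + \<gamma>))) - (\<Sum>x\<in>UNIV. centred (r x))
      + column_total \<alpha> \<gamma>"
    by (simp add: CARD_times_of_bool_less sum.distrib sum_subtractf column_total_def)
  also have "(\<Sum>x\<in>UNIV. centred (r x - (\<alpha> * x\<^sup>2 + \<gamma>))) = quadratic_sum \<alpha> k"
  proof -
    have a: "a = - (2 * \<alpha> * h * b)" using assms by (simp add: h_def)
    have "r x - (\<alpha> * x\<^sup>2 + \<gamma>) = k - \<alpha> * (x - h)\<^sup>2" for x
      using \<open>b \<noteq> 0\<close> unfolding r_def k_def a by (simp add: field_simps power2_eq_square)
    then show ?thesis
      using sum_UNIV_reindex[of "\<lambda>x. x - h" "\<lambda>x. centred (k - \<alpha> * x\<^sup>2)"]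
      by (simp add: quadratic_sum_def inj_def)
  qed
  finally show ?thesis unfolding r_def by blast
qed

text \<open>\<open>column_total\<close> is the cardinality of \<open>below_parabola\<close>, so this compares \<open>n\<close> with its mean over parallel lines.\<close>

definition exceptional :: "'p::prime_card mod_ring \<Rightarrow> 'p mod_ring \<Rightarrow> nat \<Rightarrow> bool" where
  "exceptional \<alpha> \<gamma> n \<longleftrightarrow>
    \<bar>real CARD('p) * real n - column_total \<alpha> \<gamma>\<bar> > real CARD('p) * (real CARD('p) / 4 - 1)"

text \<open>On a slanted line the second coordinate runs once through the field, so its centred sum
  is zero and \<open>quadratic_sum_bound\<close> applies. The conclusion allows
  \<open>a = b = 0\<close> because the line at infinity is exceptional too.\<close>

lemma exceptional_imp_axis_parallel:
  fixes \<alpha> :: "'p::prime_card mod_ring"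
  assumes "\<alpha> \<noteq> 0" and p: "CARD('p) \<ge> 25"
    and "exceptional \<alpha> \<gamma> (line_count (below_parabola \<alpha> \<gamma>) a b c)"
  shows "a = 0 \<or> b = 0"
proof (rule ccontr)
  assume ab: "\<not> ?thesis"
  have two: "(2 :: 'p mod_ring) \<noteq> 0" using p by (intro two_neq_zero_mod_ring) simp
  obtain k where k: "CARD('p) * line_count (below_parabola \<alpha> \<gamma>) a b c
    = quadratic_sum \<alpha> k - (\<Sum>x\<in>UNIV. centred (- (a * x + c) / b)) + column_total \<alpha> \<gamma>"
    using line_count_nonvertical[OF _ \<open>\<alpha> \<noteq> 0\<close> two] ab by blast
  have "(\<Sum>x\<in>UNIV. centred (- (a * x + c) / b)) = 0"
    using sum_UNIV_reindex[of "\<lambda>x. - (a * x + c) / b" centred] ab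
    by (simp add: sum_centred inj_def)
  then show False
    using k quadratic_sum_bound[OF \<open>\<alpha> \<noteq> 0\<close> p, of k] assms(3) by (simp add: exceptional_def)
qed

text \<open>The row \<open>y = 0\<close> is nearly full and the row \<open>y = -1\<close> is empty.\<close>

lemma exceptional_row:
  fixes \<alpha> :: "'p::prime_card mod_ring"
  assumes "\<alpha> \<noteq> 0" and p: "CARD('p) \<ge> 25" and c: "c = 0 \<or> c = 1"
  shows "exceptional \<alpha> \<gamma> (line_count (below_parabola \<alpha> \<gamma>) 0 1 c)"
proof -
  let ?p = "real CARD('p)"
  have two: "(2 :: 'p mod_ring) \<noteq> 0" using p by (intro two_neq_zero_mod_ring) simp
  obtain k where k: "CARD('p) * line_count (below_parabola \<alpha> \<gamma>) 0 1 c
    = quadratic_sum \<alpha> k - ?p * centred (- c) + column_total \<alpha> \<gamma>"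
    using line_count_nonvertical[OF _ \<open>\<alpha> \<noteq> 0\<close> two, of 1 \<gamma> 0 c] by auto
  \<comment> \<open>The representatives 0 and \<open>p - 1\<close> are the two farthest from the
    mean.\<close>
  have "\<bar>centred (- c)\<bar> = (?p - 1) / 2"
    using c p centred_diff_one[of "0 :: 'p mod_ring"] by (auto simp: centred_def field_simps)
  then have "\<bar>?p * centred (- c)\<bar> = ?p * ((?p - 1) / 2)" by (simp add: abs_mult)
  \<comment> \<open>The row term exceeds twice the exceptional threshold, and
    \<open>quadratic_sum\<close> can cancel at most one threshold of it.\<close>
  moreover have "?p * ((?p - 1) / 2) > 2 * (?p * (?p / 4 - 1))" using p by (simp add: field_simps)
  ultimately show ?thesis
    using k quadratic_sum_bound[OF \<open>\<alpha> \<noteq> 0\<close> p, of k] unfolding exceptional_def of_nat_mult by linarith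
qed

section \<open>Columns as initial segments\<close>

definition initial_segment :: "'p::prime_card mod_ring \<Rightarrow> 'p mod_ring set" where
  "initial_segment n = {y. mod_ring_less y n}"

lemma initial_segment_eq: "initial_segment n = of_nat ` {..<nat (to_int_mod_ring n)}"
  for n :: "'p::prime_card mod_ring"
proof (intro equalityI subsetI)
  fix y assume "y \<in> initial_segment n"
  then have "nat (to_int_mod_ring y) < nat (to_int_mod_ring n)"
    using to_int_mod_ring_bounds[of y] by (simp add: initial_segment_def mod_ring_less_def)
  moreover have "of_nat (nat (to_int_mod_ring y)) = y"
    using to_int_mod_ring_bounds[of y] by (simp add: of_nat_of_int_mod_ring)
  ultimately show "y \<in> of_nat ` {..<nat (to_int_mod_ring n)}" by (metis image_eqI lessThan_iff)
next
  fix y :: "'p mod_ring" assume "y \<in> of_nat ` {..<nat (to_int_mod_ring n)}"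
  then show "y \<in> initial_segment n" using to_int_mod_ring_bounds[of n]
    by (auto simp: initial_segment_def mod_ring_less_def of_nat_of_int_mod_ring)
qed

lemma inj_on_of_nat_mod_ring:
  "inj_on (of_nat :: nat \<Rightarrow> 'p mod_ring) {..<nat (to_int_mod_ring (n :: 'p::prime_card mod_ring))}"
proof (rule inj_on_inverseI[where g = "\<lambda>y. nat (to_int_mod_ring y)"])
  fix i assume "i \<in> {..<nat (to_int_mod_ring n)}"
  then show "nat (to_int_mod_ring (of_nat i :: 'p mod_ring)) = i"
    using to_int_mod_ring_bounds[of n] by (simp add: of_nat_of_int_mod_ring)
qed

lemma card_initial_segment: "card (initial_segment n) = nat (to_int_mod_ring n)"
  by (simp add: initial_segment_eq card_image inj_on_of_nat_mod_ring)

text \<open>Through this cast an equality of column sizes becomes an equation between values of the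
  parabola in the field.\<close>

lemma of_nat_card_initial_segment: "of_nat (card (initial_segment n)) = n"
  using to_int_mod_ring_bounds[of n] by (simp add: card_initial_segment of_nat_of_int_mod_ring)

lemma sum_initial_segment: "2 * (\<Sum>y\<in>initial_segment n. y) = n * (n - 1)" for n :: "'p::prime_card mod_ring"
proof -
  have "2 * (\<Sum>i<m. of_nat i) = of_nat m * (of_nat m - 1 :: 'p mod_ring)" for m
    by (induction m) (auto simp: algebra_simps)
  from this[of "card (initial_segment n)"]
  have "2 * (\<Sum>i<card (initial_segment n). of_nat i) = n * (n - 1)"
    by (simp only: of_nat_card_initial_segment)
  then show ?thesis
    unfolding card_initial_segment by (simp add: initial_segment_eq sum.reindex inj_on_of_nat_mod_ring o_def)
qed

text \<open>Centroids of columns moved by an affine map are compared through this formula; the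
  factor 2 avoids a division.\<close>

lemma sum_affine_initial_segment: "2 * (\<Sum>y\<in>initial_segment n. a * y + b) = a * (n * (n - 1)) + 2 * b * n"
  for n :: "'p::prime_card mod_ring"
proof -
  have "(\<Sum>y\<in>initial_segment n. a * y + b) = a * (\<Sum>y\<in>initial_segment n. y) + n * b"
    by (simp add: sum.distrib sum_distrib_left of_nat_card_initial_segment)
  then have "2 * (\<Sum>y\<in>initial_segment n. a * y + b) = a * (2 * (\<Sum>y\<in>initial_segment n. y)) + 2 * b * n"
    by (simp add: algebra_simps)
  then show ?thesis by (simp add: sum_initial_segment)
qed

lemma mem_below_parabola: "(x, y) \<in> below_parabola \<alpha> \<gamma> \<longleftrightarrow> y \<in> initial_segment (\<alpha> * x\<^sup>2 + \<gamma>)"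
  by (simp add: below_parabola_def initial_segment_def)

lemma line_count_column:
  "line_count (below_parabola \<alpha> \<gamma>) 1 0 (- x) = nat (to_int_mod_ring (\<alpha> * x\<^sup>2 + \<gamma>))"
  unfolding line_count_def card_initial_segment[symmetric]
  by (rule bij_betw_same_card[of snd], rule bij_betw_byWitness[where f' = "\<lambda>y. (x, y)"])
    (auto simp: mem_below_parabola)

text \<open>
  The parabola takes \<open>(p - 1) / 2\<close> values at nonzero \<open>x\<close>; this is more than the number of integers in
  the interval of length \<open>p / 2 - 2\<close> around the mean.
\<close>

lemma exists_exceptional_column:
  fixes \<alpha> :: "'p::prime_card mod_ring"
  assumes "\<alpha> \<noteq> 0" and p: "CARD('p) \<ge> 25"
  shows "\<exists>x. x \<noteq> 0 \<and> exceptional \<alpha> \<gamma> (nat (to_int_mod_ring (\<alpha> * x\<^sup>2 + \<gamma>)))"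
proof (rule ccontr)
  assume none: "\<not> ?thesis"
  let ?p = "real CARD('p)"
  define f where "f x = \<alpha> * x\<^sup>2 + \<gamma>" for x
  \<comment> \<open>The point 0 is left out because a nonzero \<open>x\<close> later supplies a
    second exceptional column at \<open>- x\<close>.\<close>
  define I where "I = f ` (UNIV - {0})"
  define u where "u = column_total \<alpha> \<gamma> / ?p"
  let ?J = "{\<lceil>u - (?p / 4 - 1)\<rceil>..\<lfloor>u + (?p / 4 - 1)\<rfloor>}"
  have "\<bar>of_int (to_int_mod_ring (f x)) - u\<bar> \<le> ?p / 4 - 1" if "x \<noteq> 0" for x
  proof -
    let ?n = "real_of_int (to_int_mod_ring (f x))"
    have "\<bar>?p * ?n - column_total \<alpha> \<gamma>\<bar> \<le> ?p * (?p / 4 - 1)"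
      using none that to_int_mod_ring_bounds[of "f x"] by (auto simp: exceptional_def f_def)
    moreover have "?p * ?n - column_total \<alpha> \<gamma> = ?p * (?n - u)"
      by (simp add: u_def algebra_simps)
    ultimately show ?thesis by (simp add: abs_mult)
  qed
  then have sub: "to_int_mod_ring ` I \<subseteq> ?J"
    by (auto simp: I_def abs_le_iff ceiling_le_iff le_floor_iff) (smt (verit))+
  have "card I = card (to_int_mod_ring ` I)"
    by (rule card_image[symmetric]) (metis inj_onI of_int_mod_ring_to_int_mod_ring)
  also have "\<dots> \<le> card ?J" by (rule card_mono[OF _ sub]) simp
  finally have "real (card I) \<le> real (card ?J)" by simp
  also have "\<dots> \<le> ?p / 2 - 1" using p by simp linarith
  finally have "real (card I) \<le> ?p / 2 - 1" .
  moreover have "CARD('p) - 1 \<le> 2 * card I"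
  proof -
    have "UNIV - {0} \<subseteq> (\<Union>t\<in>I. {x. \<alpha> * x\<^sup>2 = t - \<gamma>})" by (auto simp: I_def f_def)
    then have "card (UNIV - {0 :: 'p mod_ring}) \<le> card (\<Union>t\<in>I. {x. \<alpha> * x\<^sup>2 = t - \<gamma>})"
      by (rule card_mono[rotated]) simp
    also have "\<dots> \<le> (\<Sum>t\<in>I. card {x. \<alpha> * x\<^sup>2 = t - \<gamma>})" by (rule card_UN_le) simp
    also have "\<dots> \<le> (\<Sum>t\<in>I. 2)" by (intro sum_mono card_quadratic_fibre_le assms)
    finally show ?thesis by (simp add: mult.commute)
  qed
  \<comment> \<open>The two bounds say \<open>p - 1 \<le> 2 * card I\<close> and
    \<open>2 * card I \<le> p - 2\<close>.\<close>
  ultimately show False using p by linarith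
qed


section \<open>Projectivities stabilising the set\<close>

definition affine_vector :: "'a::field \<times> 'a \<Rightarrow> 'a ^ 3" where
  "affine_vector q = vector [fst q, snd q, 1]"

lemma affine_vector_nth [simp]:
  "affine_vector q $ 1 = fst q" "affine_vector q $ 2 = snd q" "affine_vector q $ 3 = 1"
  by (simp_all add: affine_vector_def)

text \<open>The common last coordinate 1 fixes the scalar.\<close>

lemma affine_vector_eq_iff: "affine_vector q = c *s affine_vector q' \<longleftrightarrow> c = 1 \<and> q = q'"
  by (auto simp: vec_eq_iff forall_3 prod_eq_iff)

lemma AG2_embed_eq_span: "AG2_embed q = vec.span {affine_vector q}"
  by (simp add: AG2_embed_def homogeneous_point_def affine_vector_def case_prod_unfold)

lemma PGL3_act_AG2_embed:
  "PGL3_act (PGL3_class A) (AG2_embed q) = vec.span {A *v affine_vector q}"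
  using AG2_embed_in_PG2[of q] by (simp add: PGL3_act_class AG2_embed_eq_span matrix_image_span)

text \<open>The scalar \<open>c\<close> may vary with \<open>q\<close>, since the projectivity is
  not yet known to be affine. Invertibility and the normalised last coordinate make
  \<open>\<sigma>\<close> injective; finiteness of \<open>S\<close> makes it bijective.\<close>

lemma stabiliser_imp_bij_betw:
  fixes A :: "'a::field ^ 3 ^ 3"
  assumes A: "invertible A" and "finite S"
    and stab: "PGL3_act (PGL3_class A) ` (AG2_embed ` S) = AG2_embed ` S"
  shows "\<exists>\<sigma>. bij_betw \<sigma> S S
    \<and> (\<forall>q\<in>S. \<exists>c. c \<noteq> 0 \<and> A *v affine_vector q = c *s affine_vector (\<sigma> q))"
proof -
  have inj: "inj ((*v) A)" using A by (rule inj_matrix_vector_mult)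
  have "\<exists>q'\<in>S. \<exists>c. c \<noteq> 0 \<and> A *v affine_vector q = c *s affine_vector q'" if "q \<in> S" for q
  proof -
    have "PGL3_act (PGL3_class A) (AG2_embed q) \<in> AG2_embed ` S" using stab that by blast
    then obtain q' where q': "q' \<in> S" "PGL3_act (PGL3_class A) (AG2_embed q) = AG2_embed q'"
      by blast
    from q'(2) have "vec.span {A *v affine_vector q} = vec.span {affine_vector q'}"
      by (simp only: PGL3_act_AG2_embed) (simp only: AG2_embed_eq_span)
    then have "A *v affine_vector q \<in> vec.span {affine_vector q'}"
      by (metis insertI1 vec.span_base)
    then obtain c where c: "A *v affine_vector q = c *s affine_vector q'"
      by (auto simp: vec.span_singleton)
    have "affine_vector q \<noteq> 0" by (metis affine_vector_nth(3) zero_index zero_neq_one)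
    then have "A *v affine_vector q \<noteq> 0" using inj by (metis injD matrix_vector_mult_0_right)
    then have "c \<noteq> 0" using c by auto
    then show ?thesis using q' c by blast
  qed
  then obtain \<sigma> where \<sigma>: "\<And>q. q \<in> S \<Longrightarrow> \<sigma> q \<in> S"
    "\<And>q. q \<in> S \<Longrightarrow> \<exists>c. c \<noteq> 0 \<and> A *v affine_vector q = c *s affine_vector (\<sigma> q)"
    by metis
  have "inj_on \<sigma> S"
  proof (rule inj_onI)
    fix q q' assume *: "q \<in> S" "q' \<in> S" "\<sigma> q = \<sigma> q'"
    obtain c c' where c: "c' \<noteq> 0" "A *v affine_vector q = c *s affine_vector (\<sigma> q)"
      "A *v affine_vector q' = c' *s affine_vector (\<sigma> q)"
      using \<sigma>(2)[OF *(1)] \<sigma>(2)[OF *(2)] *(3) by metis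
    then have "A *v affine_vector q = (c / c') *s (A *v affine_vector q')"
      by (simp add: vec_eq_iff)
    also have "\<dots> = A *v ((c / c') *s affine_vector q')" by (simp add: vec.scale)
    finally show "q = q'" using injD[OF inj] affine_vector_eq_iff by metis
  qed
  moreover have "\<sigma> ` S \<subseteq> S" using \<sigma>(1) by blast
  ultimately have "bij_betw \<sigma> S S"
    using endo_inj_surj[OF \<open>finite S\<close>] by (simp add: bij_betw_def)
  then show ?thesis using \<sigma>(2) by blast
qed

text \<open>Evaluating a linear form at \<open>A *v affine_vector q\<close> is evaluating its
  pullback at \<open>q\<close>. The nonzero scalar does not affect vanishing, so
  \<open>\<sigma>\<close> carries the points of \<open>S\<close> on the pulled-back line bijectively
  to those on the given one.\<close>

lemma line_count_stabiliser:
  fixes A :: "'a::field ^ 3 ^ 3"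
  assumes \<sigma>: "bij_betw \<sigma> S S"
    and A: "\<And>q. q \<in> S \<Longrightarrow> \<exists>c. c \<noteq> 0 \<and> A *v affine_vector q = c *s affine_vector (\<sigma> q)"
  shows "line_count S (a * A$1$1 + b * A$2$1 + c * A$3$1) (a * A$1$2 + b * A$2$2 + c * A$3$2)
    (a * A$1$3 + b * A$2$3 + c * A$3$3) = line_count S a b c"
proof -
  define L where "L q \<longleftrightarrow> a * fst q + b * snd q + c = 0" for q
  define L' where "L' q \<longleftrightarrow> (a * A$1$1 + b * A$2$1 + c * A$3$1) * fst q
    + (a * A$1$2 + b * A$2$2 + c * A$3$2) * snd q + (a * A$1$3 + b * A$2$3 + c * A$3$3) = 0" for q
  have iff: "L' q \<longleftrightarrow> L (\<sigma> q)" if q: "q \<in> S" for q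
  proof -
    obtain d where d: "d \<noteq> 0" "A *v affine_vector q = d *s affine_vector (\<sigma> q)"
      using A[OF q] by blast
    have e: "A$i$1 * fst q + A$i$2 * snd q + A$i$3 = d * affine_vector (\<sigma> q) $ i" for i
      using arg_cong[OF d(2), of "\<lambda>v. v $ i"] by (simp add: matrix_vector_mult_def sum_3)
    have "(a * A$1$1 + b * A$2$1 + c * A$3$1) * fst q
      + (a * A$1$2 + b * A$2$2 + c * A$3$2) * snd q + (a * A$1$3 + b * A$2$3 + c * A$3$3)
      = a * (A$1$1 * fst q + A$1$2 * snd q + A$1$3) + b * (A$2$1 * fst q + A$2$2 * snd q + A$2$3)
      + c * (A$3$1 * fst q + A$3$2 * snd q + A$3$3)"
      by (simp add: algebra_simps)
    also have "\<dots> = d * (a * fst (\<sigma> q) + b * snd (\<sigma> q) + c)"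
      unfolding e by (simp add: algebra_simps)
    finally show ?thesis using d(1) unfolding L_def L'_def by simp
  qed
  have "\<sigma> ` {q \<in> S. L' q} = {q \<in> \<sigma> ` S. L q}"
    using iff by auto
  then have "\<sigma> ` {q \<in> S. L' q} = {q \<in> S. L q}"
    by (simp only: bij_betw_imp_surj_on[OF \<sigma>])
  moreover have "inj_on \<sigma> {q \<in> S. L' q}"
    using \<sigma> by (auto simp: bij_betw_def intro: inj_on_subset)
  ultimately have "card {q \<in> S. L' q} = card {q \<in> S. L q}" by (metis card_image)
  then show ?thesis by (simp add: line_count_def L_def L'_def case_prod_unfold)
qed

text \<open>
  The matrix pulls the line with coefficients \<open>(a, b, c)\<close> back to the one with coefficients \<open>(a, b, c) A\<close>. It is
  applied to the exceptional lines \<open>z = 0\<close>, \<open>y = 0\<close>, \<open>y = -1\<close> and two vertical ones.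
\<close>

lemma stabiliser_imp_axis_permuting:
  fixes \<alpha> :: "'p::prime_card mod_ring" and A :: "'p mod_ring ^ 3 ^ 3"
  assumes "\<alpha> \<noteq> 0" and p: "CARD('p) \<ge> 25" and inv: "invertible A"
    and count: "\<And>a b c. line_count (below_parabola \<alpha> \<gamma>) (a * A$1$1 + b * A$2$1 + c * A$3$1)
      (a * A$1$2 + b * A$2$2 + c * A$3$2) (a * A$1$3 + b * A$2$3 + c * A$3$3)
      = line_count (below_parabola \<alpha> \<gamma>) a b c"
  shows "A$3$1 = 0 \<and> A$3$2 = 0 \<and>
    (A$1$2 = 0 \<and> A$2$1 = 0 \<and> A$1$1 \<noteq> 0 \<and> A$2$2 \<noteq> 0
      \<or> A$1$1 = 0 \<and> A$2$2 = 0 \<and> A$1$2 \<noteq> 0 \<and> A$2$1 \<noteq> 0)"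
proof -
  have two: "(2 :: 'p mod_ring) \<noteq> 0" using p by (intro two_neq_zero_mod_ring) simp
  \<comment> \<open>Exceptionality depends on the count alone, so the pullback of an exceptional
    line is exceptional and has a zero coefficient.\<close>
  have *: "a * A$1$1 + b * A$2$1 + c * A$3$1 = 0 \<or> a * A$1$2 + b * A$2$2 + c * A$3$2 = 0"
    if "exceptional \<alpha> \<gamma> (line_count (below_parabola \<alpha> \<gamma>) a b c)" for a b c
    using exceptional_imp_axis_parallel[OF assms(1,2)] that count by metis
  obtain x where x: "x \<noteq> 0" "exceptional \<alpha> \<gamma> (nat (to_int_mod_ring (\<alpha> * x\<^sup>2 + \<gamma>)))"
    using exists_exceptional_column[OF assms(1,2)] by blast
  have col: "A$1$1 - x * A$3$1 = 0 \<or> A$1$2 - x * A$3$2 = 0"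
    "A$1$1 + x * A$3$1 = 0 \<or> A$1$2 + x * A$3$2 = 0"
    using *[of 1 0 "- x"] *[of 1 0 "- (- x)"] x(2) by (simp_all only: line_count_column) simp_all
  have row: "A$2$1 = 0 \<or> A$2$2 = 0" "A$2$1 + A$3$1 = 0 \<or> A$2$2 + A$3$2 = 0"
    using *[of 0 1 0] *[of 0 1 1] exceptional_row[OF assms(1,2), of _ \<gamma>] by simp_all
  \<comment> \<open>The row \<open>y = -1\<close> contains no point of the set, just like the line
    at infinity, so both have the same count.\<close>
  have infinity: "A$3$1 = 0 \<or> A$3$2 = 0"
  proof -
    have "real_of_int (to_int_mod_ring (- 1 :: 'p mod_ring)) = real CARD('p) - 1"
      using centred_diff_one[of "0 :: 'p mod_ring"] by (simp add: centred_def)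
    then have "\<not> mod_ring_less (- 1) y" for y :: "'p mod_ring"
      using to_int_mod_ring_bounds(2)[of y] unfolding mod_ring_less_def by linarith
    then have "line_count (below_parabola \<alpha> \<gamma>) 0 0 1 = line_count (below_parabola \<alpha> \<gamma>) 0 1 1"
      by (auto simp: line_count_def below_parabola_def add_eq_0_iff2 intro!: arg_cong[of _ _ card])
    then show ?thesis using *[of 0 0 1] exceptional_row[OF assms(1,2), of 1 \<gamma>] by simp
  qed
  have cancel: "u = 0 \<and> v = 0" if "u - x * v = 0" "u + x * v = 0" for u v
  proof -
    have "2 * u = (u - x * v) + (u + x * v)" by simp
    then show ?thesis using that two x(1) by simp
  qed
  have injA: "inj ((*v) A)" using inv by (rule inj_matrix_vector_mult)
  have nonzero: "\<not> (A$1$j = 0 \<and> A$2$j = 0 \<and> A$3$j = 0)" for j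
  proof
    assume "A$1$j = 0 \<and> A$2$j = 0 \<and> A$3$j = 0"
    then have "A *v axis j 1 = A *v 0"
      by (simp add: vec_eq_iff forall_3 matrix_vector_mult_def axis_def if_distrib cong: if_cong)
    then have "axis j 1 = (0 :: 'p mod_ring ^ 3)" using injA by (meson injD)
    then show False by (metis axis_nth zero_index zero_neq_one)
  qed
  \<comment> \<open>If this entry were nonzero, the line at infinity, the two columns and the two
    rows would in turn force all entries of the second column of \<open>A\<close> to be 0.\<close>
  have "A$3$1 = 0"
  proof (rule ccontr)
    assume "A$3$1 \<noteq> 0"
    then have "A$3$2 = 0" using infinity by simp
    moreover have "A$1$2 = 0"
      using col \<open>A$3$2 = 0\<close> cancel[of "A$1$1" "A$3$1"] \<open>A$3$1 \<noteq> 0\<close> by auto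
    moreover have "A$2$2 = 0" using row \<open>A$3$2 = 0\<close> \<open>A$3$1 \<noteq> 0\<close> by auto
    ultimately show False using nonzero[of 2] by simp
  qed
  moreover have "A$3$2 = 0"
  proof (rule ccontr)
    assume "A$3$2 \<noteq> 0"
    moreover have "A$1$1 = 0"
      using col \<open>A$3$1 = 0\<close> cancel[of "A$1$2" "A$3$2"] \<open>A$3$2 \<noteq> 0\<close> by auto
    moreover have "A$2$1 = 0" using row \<open>A$3$1 = 0\<close> \<open>A$3$2 \<noteq> 0\<close> by auto
    ultimately show False using nonzero[of 1] \<open>A$3$1 = 0\<close> by simp
  qed
  moreover from calculation have "A$1$1 = 0 \<or> A$1$2 = 0" "A$2$1 = 0 \<or> A$2$2 = 0"
    using col row by simp_all
  ultimately show ?thesis using nonzero[of 1] nonzero[of 2] by blast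
qed


section \<open>Centroids of columns and rows\<close>

text \<open>The hypothesis expresses that \<open>a * y + b\<close> sums to zero over each column.
  Dividing by a nonzero value \<open>s\<close> of the parabola leaves
  \<open>a * (s - 1) + 2 * b = 0\<close>, and two distinct such values force both coefficients to
  vanish.\<close>

lemma affine_segment_sums_zero_imp_zero:
  fixes \<alpha> :: "'p::prime_card mod_ring"
  assumes "\<alpha> \<noteq> 0" and p: "CARD('p) \<ge> 5"
    and *: "\<And>x. a * ((\<alpha> * x\<^sup>2 + \<gamma>) * (\<alpha> * x\<^sup>2 + \<gamma> - 1)) + 2 * b * (\<alpha> * x\<^sup>2 + \<gamma>) = 0"
  shows "a = 0 \<and> b = 0"
proof -
  have two: "(2 :: 'p mod_ring) \<noteq> 0" using p by (intro two_neq_zero_mod_ring) simp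
  have three: "(3 :: 'p mod_ring) \<noteq> 0"
    using of_nat_mod_ring_eq_0_iff[where 'p = 'p, of 3] p by (auto dest: dvd_imp_le)
  have step: "a = 0 \<and> b = 0"
    if "s \<noteq> t" "s \<noteq> 0" "t \<noteq> 0" "a * (s * (s - 1)) + 2 * b * s = 0"
      "a * (t * (t - 1)) + 2 * b * t = 0" for s t :: "'p mod_ring"
  proof -
    have "s * (a * (s - 1) + 2 * b) = 0" "t * (a * (t - 1) + 2 * b) = 0"
      using that(4,5) by (simp_all add: algebra_simps)
    then have st: "a * (s - 1) + 2 * b = 0" "a * (t - 1) + 2 * b = 0" using that by simp_all
    have "a * (s - t) = (a * (s - 1) + 2 * b) - (a * (t - 1) + 2 * b)" by (simp add: algebra_simps)
    then have "a = 0" using st that(1) by simp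
    then show ?thesis using st two by simp
  qed
  \<comment> \<open>These are the values of the parabola at 0, 1 and 2; being distinct, at least two
    of them are nonzero.\<close>
  have "\<gamma> \<noteq> \<alpha> + \<gamma>" "\<gamma> \<noteq> 4 * \<alpha> + \<gamma>" "\<alpha> + \<gamma> \<noteq> 4 * \<alpha> + \<gamma>"
  proof -
    have "4 * \<alpha> + \<gamma> - \<gamma> = 2 * (2 * \<alpha>)" by simp
    then show "\<gamma> \<noteq> 4 * \<alpha> + \<gamma>" using two \<open>\<alpha> \<noteq> 0\<close> by (metis diff_self mult_eq_0_iff)
    have "4 * \<alpha> + \<gamma> - (\<alpha> + \<gamma>) = 3 * \<alpha>" by (simp add: algebra_simps)
    then show "\<alpha> + \<gamma> \<noteq> 4 * \<alpha> + \<gamma>" using three \<open>\<alpha> \<noteq> 0\<close> by (metis diff_self mult_eq_0_iff)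
  qed (use \<open>\<alpha> \<noteq> 0\<close> in simp)
  moreover have "a * (\<gamma> * (\<gamma> - 1)) + 2 * b * \<gamma> = 0"
    "a * ((\<alpha> + \<gamma>) * (\<alpha> + \<gamma> - 1)) + 2 * b * (\<alpha> + \<gamma>) = 0"
    "a * ((4 * \<alpha> + \<gamma>) * (4 * \<alpha> + \<gamma> - 1)) + 2 * b * (4 * \<alpha> + \<gamma>) = 0"
    using *[of 0] *[of 1] *[of 2] by (simp_all add: mult.commute)
  ultimately show ?thesis using step by metis
qed

text \<open>Such a map sends columns to columns. Comparing their sizes gives
  \<open>f (a * x + b) = f x\<close> for the quadratic \<open>f\<close>, which settles
  \<open>a\<close> and \<open>b\<close>; comparing their sums then settles \<open>c\<close> and
  \<open>d\<close>.\<close>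

lemma stabiliser_diagonal:
  fixes \<alpha> :: "'p::prime_card mod_ring"
  assumes \<alpha>: "\<alpha> \<noteq> 0" and p: "CARD('p) \<ge> 5" and "a \<noteq> 0" "c \<noteq> 0"
    and \<sigma>: "bij_betw (\<lambda>(x, y). (a * x + b, c * y + d)) (below_parabola \<alpha> \<gamma>) (below_parabola \<alpha> \<gamma>)"
  shows "(a = 1 \<or> a = - 1) \<and> b = 0 \<and> c = 1 \<and> d = 0"
proof -
  define f where "f x = \<alpha> * x\<^sup>2 + \<gamma>" for x
  have img: "(\<lambda>y. c * y + d) ` initial_segment (f x) = initial_segment (f (a * x + b))" for x
  proof (intro equalityI subsetI)
    fix y' assume "y' \<in> (\<lambda>y. c * y + d) ` initial_segment (f x)"
    then obtain y where y: "(x, y) \<in> below_parabola \<alpha> \<gamma>" "y' = c * y + d"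
      by (auto simp: mem_below_parabola f_def)
    from bij_betwE[OF \<sigma>] y(1) have "(a * x + b, c * y + d) \<in> below_parabola \<alpha> \<gamma>" by auto
    then show "y' \<in> initial_segment (f (a * x + b))" by (simp add: y(2) mem_below_parabola f_def)
  next
    fix y' assume "y' \<in> initial_segment (f (a * x + b))"
    then have "(a * x + b, y') \<in> below_parabola \<alpha> \<gamma>" by (simp add: mem_below_parabola f_def)
    then have "(a * x + b, y') \<in> (\<lambda>(x, y). (a * x + b, c * y + d)) ` below_parabola \<alpha> \<gamma>"
      by (simp only: bij_betw_imp_surj_on[OF \<sigma>])
    then obtain x0 y0 where *: "(x0, y0) \<in> below_parabola \<alpha> \<gamma>" "a * x + b = a * x0 + b" "y' = c * y0 + d"
      by auto
    then have "x0 = x" using \<open>a \<noteq> 0\<close> by simp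
    then show "y' \<in> (\<lambda>y. c * y + d) ` initial_segment (f x)"
      using * by (auto simp: mem_below_parabola f_def)
  qed
  have inj: "inj_on (\<lambda>y. c * y + d) X" for X using \<open>c \<noteq> 0\<close> by (simp add: inj_on_def)
  have f_eq: "f (a * x + b) = f x" for x
    using arg_cong[OF img[of x], of card]
    by (metis card_image[OF inj] of_nat_card_initial_segment)
  have b: "b = 0" using f_eq[of 0] \<alpha> by (simp add: f_def)
  have "a\<^sup>2 = 1" using f_eq[of 1] \<alpha> b by (simp add: f_def)
  then have a: "a = 1 \<or> a = - 1" by (simp add: power2_eq_1_iff)
  have "(c - 1) * (f x * (f x - 1)) + 2 * d * f x = 0" for x
  proof -
    have "f x * (f x - 1) = 2 * (\<Sum>y\<in>initial_segment (f x). y)" by (simp add: sum_initial_segment)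
    also have "\<dots> = 2 * (\<Sum>y\<in>initial_segment (f x). c * y + d)"
      using img[of x] unfolding f_eq by (metis (no_types, lifting) inj sum.reindex_cong)
    also have "\<dots> = c * (f x * (f x - 1)) + 2 * d * f x" by (rule sum_affine_initial_segment)
    finally show ?thesis by (simp add: algebra_simps)
  qed
  then have "c - 1 = 0 \<and> d = 0" unfolding f_def by (rule affine_segment_sums_zero_imp_zero[OF \<alpha> p])
  then show ?thesis using a b by simp
qed

text \<open>Such a map would send columns onto rows. Rows are symmetric under negation of
  \<open>x\<close>, hence sum to zero, so \<open>a * y + b\<close> would sum to zero over each
  column and \<open>a\<close> would be 0.\<close>

lemma stabiliser_not_antidiagonal:
  fixes \<alpha> :: "'p::prime_card mod_ring"
  assumes \<alpha>: "\<alpha> \<noteq> 0" and p: "CARD('p) \<ge> 5" and "a \<noteq> 0" "c \<noteq> 0"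
  shows "\<not> bij_betw (\<lambda>(x, y). (a * y + b, c * x + d)) (below_parabola \<alpha> \<gamma>) (below_parabola \<alpha> \<gamma>)"
proof
  assume \<sigma>: "bij_betw (\<lambda>(x, y). (a * y + b, c * x + d)) (below_parabola \<alpha> \<gamma>) (below_parabola \<alpha> \<gamma>)"
  define f where "f x = \<alpha> * x\<^sup>2 + \<gamma>" for x
  define row where "row y = {x. (x, y) \<in> below_parabola \<alpha> \<gamma>}" for y
  have two: "(2 :: 'p mod_ring) \<noteq> 0" using p by (intro two_neq_zero_mod_ring) simp
  have img: "(\<lambda>y. a * y + b) ` initial_segment (f x) = row (c * x + d)" for x
  proof (intro equalityI subsetI)
    fix x' assume "x' \<in> (\<lambda>y. a * y + b) ` initial_segment (f x)"
    then obtain y where y: "(x, y) \<in> below_parabola \<alpha> \<gamma>" "x' = a * y + b"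
      by (auto simp: mem_below_parabola f_def)
    from bij_betwE[OF \<sigma>] y(1) have "(a * y + b, c * x + d) \<in> below_parabola \<alpha> \<gamma>" by auto
    then show "x' \<in> row (c * x + d)" by (simp add: y(2) row_def)
  next
    fix x' assume "x' \<in> row (c * x + d)"
    then have "(x', c * x + d) \<in> below_parabola \<alpha> \<gamma>" by (simp add: row_def)
    then have "(x', c * x + d) \<in> (\<lambda>(x, y). (a * y + b, c * x + d)) ` below_parabola \<alpha> \<gamma>"
      by (simp only: bij_betw_imp_surj_on[OF \<sigma>])
    then obtain x0 y0 where *: "(x0, y0) \<in> below_parabola \<alpha> \<gamma>" "c * x + d = c * x0 + d" "x' = a * y0 + b"
      by auto
    then have "x0 = x" using \<open>c \<noteq> 0\<close> by simp
    then show "x' \<in> (\<lambda>y. a * y + b) ` initial_segment (f x)"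
      using * by (auto simp: mem_below_parabola f_def)
  qed
  have row_sum: "(\<Sum>x\<in>row y. x) = 0" for y
  proof -
    have "(\<Sum>x\<in>row y. x) = (\<Sum>x\<in>row y. - x)"
      by (rule sum.reindex_bij_witness[of _ uminus uminus]) (auto simp: row_def below_parabola_def)
    then have "2 * (\<Sum>x\<in>row y. x) = 0" by (simp add: sum_negf)
    then show ?thesis using two by simp
  qed
  have inj: "inj_on (\<lambda>y. a * y + b) X" for X using \<open>a \<noteq> 0\<close> by (simp add: inj_on_def)
  have "a * (f x * (f x - 1)) + 2 * b * f x = 0" for x
  proof -
    have "a * (f x * (f x - 1)) + 2 * b * f x = 2 * (\<Sum>y\<in>initial_segment (f x). a * y + b)"
      by (rule sum_affine_initial_segment[symmetric])
    also have "\<dots> = 2 * (\<Sum>x\<in>row (c * x + d). x)"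
      using img[of x] by (metis (no_types, lifting) inj sum.reindex_cong)
    finally show ?thesis by (simp add: row_sum)
  qed
  then have "a = 0 \<and> b = 0" unfolding f_def by (rule affine_segment_sums_zero_imp_zero[OF \<alpha> p])
  then show False using \<open>a \<noteq> 0\<close> by simp
qed

section \<open>The reflection and the classification of the stabiliser\<close>

definition reflection_matrix :: "'a::field ^ 3 ^ 3" where
  "reflection_matrix = vector [vector [-1, 0, 0], vector [0, 1, 0], vector [0, 0, 1]]"

lemma reflection_matrix_affine_vector:
  "reflection_matrix *v affine_vector (x, y) = affine_vector (- x, y)"
  by (simp add: vec_eq_iff forall_3 matrix_vector_mult_def sum_3 reflection_matrix_def)

lemma invertible_reflection_matrix: "invertible (reflection_matrix :: 'a::field ^ 3 ^ 3)"
  unfolding invertible_def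
  by (rule exI[of _ reflection_matrix])
    (simp add: vec_eq_iff forall_3 matrix_matrix_mult_def sum_3 reflection_matrix_def mat_def)

lemma PGL3_class_scalar_mult:
  assumes "c \<noteq> 0"
  shows "PGL3_class (mat c ** A) = PGL3_class A"
proof -
  have "\<exists>d'. mat d ** A = mat d' ** (mat c ** A) \<and> d' \<noteq> 0" if "d \<noteq> 0" for d
    using that assms by (intro exI[of _ "d / c"]) (simp add: matrix_mul_assoc scalar_mult_scalar)
  moreover have "\<exists>d'. mat d ** (mat c ** A) = mat d' ** A \<and> d' \<noteq> 0" if "d \<noteq> 0" for d
    using that assms by (intro exI[of _ "d * c"]) (simp add: matrix_mul_assoc scalar_mult_scalar)
  ultimately show ?thesis by (auto simp: PGL3_class_eq)
qed

text \<open>A scalar matrix has equal diagonal entries, whereas -1 and 1 differ in odd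
  characteristic.\<close>

lemma PGL3_class_reflection_neq_one:
  assumes "(2 :: 'a::field) \<noteq> 0"
  shows "PGL3_class (reflection_matrix :: 'a ^ 3 ^ 3) \<noteq> \<one>\<^bsub>PGL3\<^esub>"
proof
  assume "PGL3_class (reflection_matrix :: 'a ^ 3 ^ 3) = \<one>\<^bsub>PGL3\<^esub>"
  moreover have "mat 1 ** reflection_matrix \<in> PGL3_class (reflection_matrix :: 'a ^ 3 ^ 3)"
    unfolding PGL3_class_eq by (intro CollectI exI[of _ 1]) simp
  ultimately have "(reflection_matrix :: 'a ^ 3 ^ 3) \<in> PGL3_class (mat 1)" by (simp add: one_PGL3)
  then obtain c where "reflection_matrix = (mat c :: 'a ^ 3 ^ 3)" by (auto simp: PGL3_class_eq)
  then have "reflection_matrix $ 1 $ 1 = (mat c :: 'a ^ 3 ^ 3) $ 1 $ 1"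
    "reflection_matrix $ 2 $ 2 = (mat c :: 'a ^ 3 ^ 3) $ 2 $ 2" by simp_all
  then have "- 1 = (1 :: 'a)" by (simp add: reflection_matrix_def mat_def)
  then have "(1 :: 'a) + 1 = 0" by (metis add.right_inverse)
  then show False using assms by simp
qed

lemma reflection_stabilises:
  fixes \<alpha> \<gamma> :: "'p::prime_card mod_ring"
  shows "PGL3_act (PGL3_class reflection_matrix) ` (AG2_embed ` below_parabola \<alpha> \<gamma>)
    = AG2_embed ` below_parabola \<alpha> \<gamma>"
proof -
  have act: "PGL3_act (PGL3_class reflection_matrix) (AG2_embed (x, y)) = AG2_embed (- x, y)"
    for x y :: "'p mod_ring"
    by (simp add: PGL3_act_AG2_embed reflection_matrix_affine_vector)
      (simp add: AG2_embed_eq_span)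
  have "PGL3_act (PGL3_class reflection_matrix) ` (AG2_embed ` below_parabola \<alpha> \<gamma>)
      = AG2_embed ` (\<lambda>(x, y). (- x, y)) ` below_parabola \<alpha> \<gamma>"
    unfolding image_image by (intro image_cong refl) (auto simp: act)
  also have "(\<lambda>(x, y). (- x, y)) ` below_parabola \<alpha> \<gamma> = below_parabola \<alpha> \<gamma>"
  proof (intro equalityI subsetI)
    fix q assume "q \<in> below_parabola \<alpha> \<gamma>"
    then show "q \<in> (\<lambda>(x, y). (- x, y)) ` below_parabola \<alpha> \<gamma>"
      by (intro image_eqI[of _ _ "(- fst q, snd q)"]) (auto simp: below_parabola_def)
  qed (auto simp: below_parabola_def)
  finally show ?thesis .
qed

lemma stabiliser_below_parabola:
  fixes \<alpha> \<gamma> :: "'p::prime_card mod_ring" and A :: "'p mod_ring ^ 3 ^ 3"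
  assumes \<alpha>: "\<alpha> \<noteq> 0" and p: "CARD('p) \<ge> 25" and A: "invertible A"
    and stab: "PGL3_act (PGL3_class A) ` (AG2_embed ` below_parabola \<alpha> \<gamma>)
      = AG2_embed ` below_parabola \<alpha> \<gamma>"
  shows "PGL3_class A = \<one>\<^bsub>PGL3\<^esub> \<or> PGL3_class A = PGL3_class reflection_matrix"
proof -
  let ?S = "below_parabola \<alpha> \<gamma>"
  have p5: "CARD('p) \<ge> 5" using p by simp
  obtain \<sigma> where \<sigma>: "bij_betw \<sigma> ?S ?S"
    and A\<sigma>: "\<And>q. q \<in> ?S \<Longrightarrow> \<exists>c. c \<noteq> 0 \<and> A *v affine_vector q = c *s affine_vector (\<sigma> q)"
    using stabiliser_imp_bij_betw[OF A _ stab] by auto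
  have shape: "A$3$1 = 0 \<and> A$3$2 = 0 \<and>
    (A$1$2 = 0 \<and> A$2$1 = 0 \<and> A$1$1 \<noteq> 0 \<and> A$2$2 \<noteq> 0
      \<or> A$1$1 = 0 \<and> A$2$2 = 0 \<and> A$1$2 \<noteq> 0 \<and> A$2$1 \<noteq> 0)"
    using line_count_stabiliser[OF \<sigma> A\<sigma>] by (rule stabiliser_imp_axis_permuting[OF \<alpha> p A])
  \<comment> \<open>The last row of \<open>A\<close> is \<open>(0, 0, e)\<close>, so the scalar at
    each point is \<open>e\<close>, and \<open>\<sigma>\<close> is the affine map obtained by
    dividing \<open>A\<close> by \<open>e\<close>.\<close>
  define e where "e = A$3$3"
  have "e \<noteq> 0"
  proof
    assume "e = 0"
    then have "row 3 A = 0" using shape by (simp add: row_def vec_eq_iff forall_3 e_def)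
    then have "det A = 0" by (rule det_zero_row)
    then show False using A by (simp add: invertible_det_nz)
  qed
  have \<sigma>_eq: "\<sigma> q = ((A$1$1 / e) * fst q + (A$1$2 / e) * snd q + A$1$3 / e,
      (A$2$1 / e) * fst q + (A$2$2 / e) * snd q + A$2$3 / e)" if q: "q \<in> ?S" for q
  proof -
    obtain c where c: "A *v affine_vector q = c *s affine_vector (\<sigma> q)" using A\<sigma>[OF q] by blast
    have *: "A$i$1 * fst q + A$i$2 * snd q + A$i$3 = c * affine_vector (\<sigma> q) $ i" for i
      using arg_cong[OF c, of "\<lambda>v. v $ i"] by (simp add: matrix_vector_mult_def sum_3)
    have "c = e" using *[of 3] shape by (simp add: e_def)
    then show ?thesis using *[of 1] *[of 2] \<open>e \<noteq> 0\<close>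
      by (simp add: prod_eq_iff add_divide_distrib[symmetric])
  qed
  from shape show ?thesis
  proof (elim conjE disjE)
    assume *: "A$3$1 = 0" "A$3$2 = 0" "A$1$2 = 0" "A$2$1 = 0" "A$1$1 \<noteq> 0" "A$2$2 \<noteq> 0"
    have "bij_betw (\<lambda>(x, y). (A$1$1 / e * x + A$1$3 / e, A$2$2 / e * y + A$2$3 / e)) ?S ?S"
      using \<sigma> by (rule bij_betw_cong[THEN iffD1, rotated]) (simp add: \<sigma>_eq * case_prod_unfold)
    from stabiliser_diagonal[OF \<alpha> p5 _ _ this] * \<open>e \<noteq> 0\<close>
    have "A$1$1 = e \<or> A$1$1 = - e" "A$1$3 = 0" "A$2$2 = e" "A$2$3 = 0"
      by (auto simp: field_simps)
    then have "A = mat e ** mat 1 \<or> A = mat e ** reflection_matrix"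
      using * unfolding scalar_mult_matrix
      by (auto simp: vec_eq_iff forall_3 e_def mat_def reflection_matrix_def)
    then show ?thesis
      unfolding one_PGL3 using PGL3_class_scalar_mult[OF \<open>e \<noteq> 0\<close>] by metis
  next
    assume *: "A$3$1 = 0" "A$3$2 = 0" "A$1$1 = 0" "A$2$2 = 0" "A$1$2 \<noteq> 0" "A$2$1 \<noteq> 0"
    have "bij_betw (\<lambda>(x, y). (A$1$2 / e * y + A$1$3 / e, A$2$1 / e * x + A$2$3 / e)) ?S ?S"
      using \<sigma> by (rule bij_betw_cong[THEN iffD1, rotated]) (simp add: \<sigma>_eq * case_prod_unfold)
    moreover have "A$1$2 / e \<noteq> 0" "A$2$1 / e \<noteq> 0" using * \<open>e \<noteq> 0\<close> by simp_all
    ultimately show ?thesis using stabiliser_not_antidiagonal[OF \<alpha> p5] by blast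
  qed
qed

theorem theorem3p5:
  fixes \<alpha> \<gamma> :: "'p::prime_card mod_ring"
  assumes "CARD('p) \<ge> 97"
    and "\<alpha> \<noteq> 0"
  shows "{g \<in> carrier PGL3. g \<noteq> \<one>\<^bsub>PGL3\<^esub> \<and>
      PGL3_act g ` (AG2_embed ` below_parabola \<alpha> \<gamma>) = AG2_embed ` below_parabola \<alpha> \<gamma>}
    = {PGL3_class (vector [vector [-1, 0, 0], vector [0, 1, 0], vector [0, 0, 1]])}"
  unfolding reflection_matrix_def[symmetric]
proof (intro equalityI subsetI)
  fix g assume "g \<in> {g \<in> carrier PGL3. g \<noteq> \<one>\<^bsub>PGL3\<^esub> \<and>
      PGL3_act g ` (AG2_embed ` below_parabola \<alpha> \<gamma>) = AG2_embed ` below_parabola \<alpha> \<gamma>}"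
  then show "g \<in> {PGL3_class reflection_matrix}"
    using stabiliser_below_parabola[OF assms(2)] assms(1) by (auto simp: carrier_PGL3)
next
  fix g :: "('p mod_ring ^ 3 ^ 3) set" assume "g \<in> {PGL3_class reflection_matrix}"
  moreover have "(2 :: 'p mod_ring) \<noteq> 0" using assms(1) by (intro two_neq_zero_mod_ring) simp
  ultimately show "g \<in> {g \<in> carrier PGL3. g \<noteq> \<one>\<^bsub>PGL3\<^esub> \<and>
      PGL3_act g ` (AG2_embed ` below_parabola \<alpha> \<gamma>) = AG2_embed ` below_parabola \<alpha> \<gamma>}"
    by (simp add: carrier_PGL3 PGL3_class_reflection_neq_one reflection_stabilises
        invertible_reflection_matrix)
qed

end
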